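(* Let $X,Y$ be topological spaces where $Y$ is Hausdorff and $F(Y,2)$ is contractible. Let $g:X\to Y$ be a continuous map. Then $(X,Y;g)$ has the coincidence property if and only if $\mathrm{TC}_g(\pi_{2,1}^Y)=2$.
   Context: Maps are continuous. For a map $g:X\to Y$, the triple $(X,Y;g)$ has the coincidence property (CP) if for every map $f:X\to Y$ there is a point $x\in X$ with $f(x)=g(x)$. $F(Y,2)=\{(y_1,y_2)\in Y^2\mid y_1\neq y_2\}$ with the subspace topology from $Y^2$, and $\pi_{2,1}^Y:F(Y,2)\to Y$ is $\pi_{2,1}^Y(y_1,y_2)=y_1$. The sectional number $\mathrm{sec}(f)$ of a map $f:A\to B$ is the minimal cardinality of open covers of $B$ such that for each element $U$ of the cover there is a map $s:U\to A$ with $f\circ s$ equal to the inclusion $U\hookrightarrow B$ (with value $\infty$ if no finite such cover exists). For maps $p:E\to B$ and $g:X\to B$, the relative sectional number is $\mathrm{sec}_g(p)=\mathrm{sec}(g^\ast(p))$, where $g^\ast(p):X\times_B E\to X$, $(x,e)\mapsto x$, and $X\times_B E=\{(x,e)\in X\times E: g(x)=p(e)\}$. For a space $Z$, $Z^{[0,1]}$ is the space of paths $[0,1]\to Z$ with the compact-open topology, and $e_2^Z:Z^{[0,1]}\to Z\times Z$ is $e_2^Z(\gamma)=(\gamma(0),\gamma(1))$. For a map $f:Z\to Y$, $e_f:Z^{[0,1]}\to Z\times Y$ is $e_f=(1_Z\times f)\circ e_2^Z$. For maps $f:Z\to Y$ and $g:X\to Y$, the topological complexity of $f$ relative to $g$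 is $\mathrm{TC}_g(f)=\mathrm{sec}_{1_Z\times g}(e_f)$, where $1_Z\times g:Z\times X\to Z\times Y$. *)

theory Defs
  imports "HOL-Analysis.Analysis" "HOL-Library.Extended_Nat"
begin

definition coincidence_property ::
    "'a topology \<Rightarrow> 'b topology \<Rightarrow> ('a \<Rightarrow> 'b) \<Rightarrow> bool" where
  "coincidence_property X Y g \<longleftrightarrow>
     (\<forall>f. continuous_map X Y f \<longrightarrow> (\<exists>x \<in> topspace X. f x = g x))"

text \<open>The ordered configuration space $F(Y,2)$; the projection to the first point is \<open>fst\<close>.
  The library predicate \<^const>\<open>contractible_space\<close> also holds for the empty space, so the usual
  notion of a contractible space (homotopy equivalent to a point) additionally needs a nonempty
  carrier.\<close>

definition conf2 :: "'b topology \<Rightarrow> ('b \<times> 'b) topology" where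
  "conf2 Y = subtopology (prod_topology Y Y) {(y1, y2). y1 \<noteq> y2}"

text \<open>The infimum over the empty set is \<open>\<infinity>\<close>. Sections over \<open>U\<close> are continuous for the subspace
  topology.\<close>

definition sectional_number ::
    "'a topology \<Rightarrow> 'b topology \<Rightarrow> ('a \<Rightarrow> 'b) \<Rightarrow> enat" where
  "sectional_number A B f =
     (INF \<U> \<in> {\<U>. finite \<U> \<and> (\<forall>U \<in> \<U>. openin B U) \<and> \<Union>\<U> = topspace B \<and>
                  (\<forall>U \<in> \<U>. \<exists>s. continuous_map (subtopology B U) A s \<and> (\<forall>b \<in> U. f (s b) = b))}.
        enat (card \<U>))"

definition fibre_product ::
    "'x topology \<Rightarrow> 'e topology \<Rightarrow> ('x \<Rightarrow> 'b) \<Rightarrow> ('e \<Rightarrow> 'b) \<Rightarrow> ('x \<times> 'e) topology" where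
  "fibre_product X E g p = subtopology (prod_topology X E) {(x, e). g x = p e}"

text \<open>For \<open>g : X \<rightarrow> B\<close> and \<open>p : E \<rightarrow> B\<close>. The topology of the common codomain \<open>B\<close> does not enter
  the fibre product, so it is not a parameter here, nor in \<open>rel_TC\<close> below.\<close>

definition rel_sectional_number ::
    "'x topology \<Rightarrow> 'e topology \<Rightarrow> ('x \<Rightarrow> 'b) \<Rightarrow> ('e \<Rightarrow> 'b) \<Rightarrow> enat" where
  "rel_sectional_number X E g p = sectional_number (fibre_product X E g p) X fst"

text \<open>Continuous maps from \<open>X\<close> to \<open>Y\<close> are represented by functions that are \<open>undefined\<close> off the
  carrier of \<open>X\<close>, so that distinct points of the mapping space are distinct maps. The subbasic
  set for \<open>K = {}\<close> is the set of all continuous maps, which makes that set the carrier.\<close>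

definition compact_open_topology :: "'a topology \<Rightarrow> 'b topology \<Rightarrow> ('a \<Rightarrow> 'b) topology" where
  "compact_open_topology X Y =
     topology_generated_by
       {{f \<in> extensional (topspace X). continuous_map X Y f \<and> f ` K \<subseteq> U} | K U.
          compactin X K \<and> openin Y U}"

definition path_space :: "'z topology \<Rightarrow> (real \<Rightarrow> 'z) topology" where
  "path_space Z = compact_open_topology (top_of_set {0..1}) Z"

definition e2 :: "(real \<Rightarrow> 'z) \<Rightarrow> 'z \<times> 'z" where
  "e2 \<gamma> = (\<gamma> 0, \<gamma> 1)"

definition e_map :: "('z \<Rightarrow> 'y) \<Rightarrow> (real \<Rightarrow> 'z) \<Rightarrow> 'z \<times> 'y" where
  "e_map f = map_prod id f \<circ> e2"

text \<open>\<open>rel_TC Z X f g\<close> is $\mathrm{TC}_g(f)$ for \<open>f : Z \<rightarrow> Y\<close> and \<open>g : X \<rightarrow> Y\<close>.\<close>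

definition rel_TC ::
    "'z topology \<Rightarrow> 'x topology \<Rightarrow> ('z \<Rightarrow> 'y) \<Rightarrow> ('x \<Rightarrow> 'y) \<Rightarrow> enat" where
  "rel_TC Z X f g =
     rel_sectional_number (prod_topology Z X) (path_space Z) (map_prod id g) (e_map f)"

end

theory Submission
  imports Defs
begin

text \<open>A map \<open>f\<close> without coincidence with \<open>g\<close> is the same as a lift of \<open>g\<close> through
  $\pi_{2,1}^Y$. As $Z = F(Y,2)$ is contractible, a lift \<open>h\<close> over \<open>V\<close> yields paths from
  \<open>z\<close> to \<open>h x\<close> depending continuously on \<open>(z, x) \<in> Z \<times> V\<close>; conversely, the endpoints of the paths
  starting at one fixed point of \<open>Z\<close> form a lift. Hence the coincidence property fails iff
  $\mathrm{TC}_g(\pi_{2,1}^Y) \le 1$. On the other hand always $\mathrm{TC}_g(\pi_{2,1}^Y) \le 2$: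
  for distinct points \<open>y\<^sub>1, y\<^sub>2\<close> of \<open>Y\<close>, the map \<open>g\<close> has the lift \<open>x \<mapsto> (g x, y\<^sub>i)\<close> over
  \<open>{x. g x \<noteq> y\<^sub>i}\<close>, and these two open sets cover \<open>X\<close>.\<close>

section \<open>Mapping spaces in the compact-open topology\<close>

lemma topspace_compact_open_topology:
  "topspace (compact_open_topology X Y) = {f \<in> extensional (topspace X). continuous_map X Y f}"
proof
  show "{f \<in> extensional (topspace X). continuous_map X Y f} \<subseteq> topspace (compact_open_topology X Y)"
    unfolding compact_open_topology_def topology_generated_by_topspace
    by (rule Union_upper) (auto intro!: exI[of _ "{}"])
qed (auto simp: compact_open_topology_def)

text \<open>By the tube lemma: if \<open>H\<close> maps \<open>K \<times> {x}\<close> into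
  \<open>U\<close> and \<open>K\<close> is compact, then it maps \<open>K \<times> B\<close> into
  \<open>U\<close> for a neighbourhood \<open>B\<close> of \<open>x\<close>. This turns a homotopy
  into a continuous family of paths.\<close>

lemma continuous_map_curry_compact_open:
  assumes H: "continuous_map (prod_topology T X) Z H"
  shows "continuous_map X (compact_open_topology T Z) (\<lambda>x. \<lambda>t\<in>topspace T. H (t, x))"
    (is "continuous_map _ _ ?c")
proof -
  have cont: "continuous_map T Z (?c x)" if "x \<in> topspace X" for x
    using continuous_map_compose[OF _ H, of T "\<lambda>t. (t, x)"] that
    by (auto simp: o_def continuous_map_paired intro: continuous_map_eq)
  show ?thesis
    unfolding compact_open_topology_def
  proof (rule continuous_on_generated_topo)
    show "?c ` topspace X \<subseteq> \<Union> {{f \<in> extensional (topspace T). continuous_map T Z f \<and> f ` K \<subseteq> U} |K U.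
          compactin T K \<and> openin Z U}"
      using cont topspace_compact_open_topology[of T Z]
      by (auto simp: compact_open_topology_def simp del: Union_iff)
  next
    fix W assume "W \<in> {{f \<in> extensional (topspace T). continuous_map T Z f \<and> f ` K \<subseteq> U} |K U.
          compactin T K \<and> openin Z U}"
    then obtain K U where K: "compactin T K" and U: "openin Z U"
      and W: "W = {f \<in> extensional (topspace T). continuous_map T Z f \<and> f ` K \<subseteq> U}"
      by auto
    let ?P = "{p \<in> topspace (prod_topology T X). H p \<in> U}"
    have P: "openin (prod_topology T X) ?P"
      using H U by (rule openin_continuous_map_preimage)
    have KT: "K \<subseteq> topspace T" using K by (rule compactin_subset_topspace)
    show "openin X (?c -` W \<inter> topspace X)"
    proof (subst openin_subopen, intro ballI)
      fix x assume x: "x \<in> ?c -` W \<inter> topspace X"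
      then have "?c x ` K \<subseteq> U"
        by (simp add: W)
      then have "H (t, x) \<in> U" if "t \<in> K" for t
        using KT that by (auto simp: subset_iff)
      then have KP: "K \<times> {x} \<subseteq> ?P"
        using KT x by auto
      have "x \<in> topspace X" using x by simp
      from tube_lemma_left[OF P K this KP]
      obtain A B where "openin X B" "K \<subseteq> A" "x \<in> B" and sub: "A \<times> B \<subseteq> ?P"
        by (elim exE conjE)
      moreover have "B \<subseteq> ?c -` W \<inter> topspace X"
      proof
        fix b assume "b \<in> B"
        then have b: "b \<in> topspace X"
          using \<open>openin X B\<close> openin_subset by blast
        have "H (t, b) \<in> U" if "t \<in> K" for t
          using that \<open>b \<in> B\<close> \<open>K \<subseteq> A\<close> sub by blast
        then show "b \<in> ?c -` W \<inter> topspace X"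
          using b KT cont[OF b] by (auto simp: W)
      qed
      ultimately show "\<exists>B. openin X B \<and> x \<in> B \<and> B \<subseteq> ?c -` W \<inter> topspace X"
        by blast
    qed
  qed
qed

text \<open>The preimage of an open set \<open>U\<close> is the subbasic set given by
  \<open>U\<close> and the compact set \<open>{t}\<close>.\<close>

lemma continuous_map_eval_compact_open:
  assumes "t \<in> topspace T"
  shows "continuous_map (compact_open_topology T Z) Z (\<lambda>f. f t)"
  unfolding continuous_map_def
proof (intro conjI allI impI)
  show "(\<lambda>f. f t) \<in> topspace (compact_open_topology T Z) \<rightarrow> topspace Z"
    using assms by (auto simp: topspace_compact_open_topology continuous_map_def)
  fix U assume "openin Z U"
  then have "openin (compact_open_topology T Z)
      {f \<in> extensional (topspace T). continuous_map T Z f \<and> f ` {t} \<subseteq> U}"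
    unfolding compact_open_topology_def using assms
    by (intro topology_generated_by_Basis) (auto intro!: exI[of _ "{t}"] exI[of _ U])
  then show "openin (compact_open_topology T Z) {f \<in> topspace (compact_open_topology T Z). f t \<in> U}"
    by (simp add: topspace_compact_open_topology conj_assoc)
qed

section \<open>Lifts of \<open>g\<close> and sections of the pulled-back path fibration\<close>

text \<open>Contractibility of \<open>Z\<close> makes \<open>fst\<close> and
  \<open>h \<circ> snd\<close> homotopic on \<open>Z \<times> V\<close>. The track of
  \<open>(z, x)\<close> is a path from \<open>z\<close> to \<open>h x\<close>, and
  \<open>e_map f\<close> sends it to \<open>(z, f (h x)) = (z, g x)\<close>, which is the condition
  defining the fibre product.\<close>

lemma path_section_of_lift:
  assumes Z: "contractible_space Z" and V: "V \<subseteq> topspace X"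
    and h: "continuous_map (subtopology X V) Z h" and fh: "\<And>x. x \<in> V \<Longrightarrow> f (h x) = g x"
  shows "\<exists>s. continuous_map (subtopology (prod_topology Z X) (topspace Z \<times> V))
               (fibre_product (prod_topology Z X) (path_space Z) (map_prod id g) (e_map f)) s \<and>
             (\<forall>b \<in> topspace Z \<times> V. fst (s b) = b)"
proof -
  let ?B = "subtopology (prod_topology Z X) (topspace Z \<times> V)"
  have B: "?B = prod_topology Z (subtopology X V)"
    by (simp add: prod_topology_subtopology(2))
  have "continuous_map ?B Z (h \<circ> snd)"
    unfolding B by (rule continuous_map_compose[OF continuous_map_snd h])
  moreover have "continuous_map ?B Z fst"
    unfolding B by (rule continuous_map_fst)
  ultimately have "homotopic_with (\<lambda>_. True) ?B Z fst (h \<circ> snd)"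
    using Z by (intro homotopic_into_contractible_space) auto
  then obtain H where H: "continuous_map (prod_topology (top_of_set {0..1::real}) ?B) Z H"
    and H0: "\<And>b. H (0, b) = fst b" and H1: "\<And>b. H (1, b) = h (snd b)"
    by (auto simp: homotopic_with_def)
  let ?s = "\<lambda>b. (b, \<lambda>t\<in>{0..1}. H (t, b))"
  have "continuous_map ?B (path_space Z) (\<lambda>b. \<lambda>t\<in>{0..1}. H (t, b))"
    using continuous_map_curry_compact_open[OF H] by (simp add: path_space_def)
  moreover have "continuous_map ?B (prod_topology Z X) (\<lambda>b. b)"
    by (simp add: continuous_map_from_subtopology)
  ultimately have "continuous_map ?B
      (fibre_product (prod_topology Z X) (path_space Z) (map_prod id g) (e_map f)) ?s"
    unfolding fibre_product_def
    by (auto simp: continuous_map_in_subtopology continuous_map_paired e_map_def e2_def H0 H1 fh)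
  then show ?thesis by auto
qed

text \<open>The path \<open>\<gamma>\<close> chosen by \<open>s\<close> over \<open>(z, x)\<close>
  satisfies \<open>(\<gamma> 0, f (\<gamma> 1)) = (z, g x)\<close>. With \<open>z\<close> fixed, its
  endpoint \<open>\<gamma> 1\<close> is therefore a lift of \<open>g x\<close> that varies
  continuously with \<open>x\<close>.\<close>

lemma lift_of_path_section:
  assumes z: "z \<in> topspace Z"
    and s: "continuous_map (prod_topology Z X)
              (fibre_product (prod_topology Z X) (path_space Z) (map_prod id g) (e_map f)) s"
    and fs: "\<And>b. b \<in> topspace (prod_topology Z X) \<Longrightarrow> fst (s b) = b"
  shows "\<exists>h. continuous_map X Z h \<and> (\<forall>x \<in> topspace X. f (h x) = g x)"
proof (intro exI conjI ballI)
  let ?E = "prod_topology (prod_topology Z X) (path_space Z)"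
  let ?h = "\<lambda>x. snd (s (z, x)) 1"
  have s': "continuous_map (prod_topology Z X) ?E s"
    and im: "s \<in> topspace (prod_topology Z X) \<rightarrow> {(x, e). map_prod id g x = e_map f e}"
    using s unfolding fibre_product_def continuous_map_in_subtopology by auto
  have fib: "map_prod id g (fst (s b)) = e_map f (snd (s b))"
    if "b \<in> topspace (prod_topology Z X)" for b
    using funcset_mem[OF im that] by (simp add: case_prod_unfold)
  have "continuous_map X (prod_topology Z X) (\<lambda>x. (z, x))"
    using z by (simp add: continuous_map_paired)
  then have "continuous_map X (path_space Z) (snd \<circ> s \<circ> (\<lambda>x. (z, x)))"
    by (intro continuous_map_compose[OF _ continuous_map_compose[OF s' continuous_map_snd]])
  moreover have "continuous_map (path_space Z) Z (\<lambda>\<gamma>. \<gamma> 1)"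
    unfolding path_space_def by (rule continuous_map_eval_compact_open) simp
  ultimately show "continuous_map X Z ?h"
    by (auto dest: continuous_map_compose simp: o_def)
  show "f (?h x) = g x" if "x \<in> topspace X" for x
    using fib[of "(z, x)"] fs[of "(z, x)"] that z by (simp add: e_map_def e2_def)
qed

section \<open>Small values of the sectional number\<close>

lemma sectional_number_le:
  assumes "finite \<U>" "\<And>U. U \<in> \<U> \<Longrightarrow> openin B U" "\<Union>\<U> = topspace B"
    and "\<And>U. U \<in> \<U> \<Longrightarrow> \<exists>s. continuous_map (subtopology B U) A s \<and> (\<forall>b \<in> U. f (s b) = b)"
  shows "sectional_number A B f \<le> enat (card \<U>)"
  unfolding sectional_number_def using assms by (intro INF_lower) auto

lemma sectional_number_le_1_imp_section:
  assumes le: "sectional_number A B f \<le> 1" and B: "topspace B \<noteq> {}"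
  shows "\<exists>s. continuous_map B A s \<and> (\<forall>b \<in> topspace B. f (s b) = b)"
proof -
  let ?C = "{\<U>. finite \<U> \<and> (\<forall>U \<in> \<U>. openin B U) \<and> \<Union>\<U> = topspace B \<and>
                  (\<forall>U \<in> \<U>. \<exists>s. continuous_map (subtopology B U) A s \<and> (\<forall>b \<in> U. f (s b) = b))}"
  \<comment> \<open>A strict bound on an infimum yields a witness, hence \<open>< 2\<close> in place
    of \<open>\<le> 1\<close>.\<close>
  have "(INF \<U> \<in> ?C. enat (card \<U>)) < 2"
    using le by (simp add: sectional_number_def order.strict_trans1)
  then obtain \<U> where \<U>: "\<U> \<in> ?C" and "enat (card \<U>) < 2"
    by (auto simp: INF_less_iff)
  then have "card \<U> < 2"
    by (simp add: numeral_eq_enat)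
  \<comment> \<open>The empty family has cardinality 0 but covers only an empty base; a single
    member must be the whole base.\<close>
  moreover have "\<U> \<noteq> {}"
    using \<U> B by blast
  ultimately have "card \<U> = 1"
    using \<U> by (simp add: less_2_cases_iff)
  then obtain U where "\<U> = {U}"
    by (rule card_1_singletonE)
  with \<U> show ?thesis by auto
qed

section \<open>Bounds on \<open>rel_TC\<close> from local and global lifts\<close>

text \<open>The sets \<open>topspace Z \<times> V\<close> cover the product, and each lift over
  \<open>V\<close> gives a section over the corresponding set by
  \<open>path_section_of_lift\<close>.\<close>

lemma rel_TC_le:
  assumes Z: "contractible_space Z" and "finite \<V>" "\<And>V. V \<in> \<V> \<Longrightarrow> openin X V" "\<Union>\<V> = topspace X"
    and lift: "\<And>V. V \<in> \<V> \<Longrightarrow> \<exists>h. continuous_map (subtopology X V) Z h \<and> (\<forall>x \<in> V. f (h x) = g x)"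
  shows "rel_TC Z X f g \<le> enat (card \<V>)"
proof -
  let ?\<U> = "(\<lambda>V. topspace Z \<times> V) ` \<V>"
  have "rel_TC Z X f g \<le> enat (card ?\<U>)"
    unfolding rel_TC_def rel_sectional_number_def
  proof (rule sectional_number_le)
    show "\<Union> ?\<U> = topspace (prod_topology Z X)"
      using \<open>\<Union>\<V> = topspace X\<close> by auto
    fix U assume "U \<in> ?\<U>"
    then obtain V where V: "V \<in> \<V>" and U: "U = topspace Z \<times> V" by auto
    show "openin (prod_topology Z X) U"
      using assms(3)[OF V] by (simp add: U openin_prod_Times_iff)
    obtain h where "continuous_map (subtopology X V) Z h" "\<forall>x \<in> V. f (h x) = g x"
      using lift[OF V] by auto
    then show "\<exists>s. continuous_map (subtopology (prod_topology Z X) U)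
               (fibre_product (prod_topology Z X) (path_space Z) (map_prod id g) (e_map f)) s \<and>
             (\<forall>b \<in> U. fst (s b) = b)"
      unfolding U using assms(3)[OF V] Z
      by (intro path_section_of_lift[where h=h]) (auto dest: openin_subset)
  qed (use \<open>finite \<V>\<close> in auto)
  \<comment> \<open>Only an inequality: \<open>V \<mapsto> topspace Z \<times> V\<close> collapses
    all members when \<open>Z\<close> is empty.\<close>
  also have "\<dots> \<le> enat (card \<V>)"
    using card_image_le[OF \<open>finite \<V>\<close>] by simp
  finally show ?thesis .
qed

lemma rel_TC_le_1_iff:
  assumes Z: "contractible_space Z" "topspace Z \<noteq> {}"
  shows "rel_TC Z X f g \<le> 1 \<longleftrightarrow> (\<exists>h. continuous_map X Z h \<and> (\<forall>x \<in> topspace X. f (h x) = g x))"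
proof
  assume le: "rel_TC Z X f g \<le> 1"
  obtain z where z: "z \<in> topspace Z" using Z(2) by blast
  show "\<exists>h. continuous_map X Z h \<and> (\<forall>x \<in> topspace X. f (h x) = g x)"
  \<comment> \<open>If \<open>X\<close> is empty, so is the base \<open>Z \<times> X\<close>, and
    the empty cover provides no section; any function, such as a constant one, is then a
    lift.\<close>
  proof (cases "topspace X = {}")
    case True
    then show ?thesis
      using z by (intro exI[of _ "\<lambda>_. z"]) simp
  next
    case False
    then have "topspace (prod_topology Z X) \<noteq> {}"
      using z by auto
    from sectional_number_le_1_imp_section[OF le[unfolded rel_TC_def rel_sectional_number_def] this]
    obtain s where "continuous_map (prod_topology Z X)
        (fibre_product (prod_topology Z X) (path_space Z) (map_prod id g) (e_map f)) s"
      and "\<forall>b \<in> topspace (prod_topology Z X). fst (s b) = b"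
      by blast
    then show ?thesis
      using lift_of_path_section[OF z] by blast
  qed
next
  assume "\<exists>h. continuous_map X Z h \<and> (\<forall>x \<in> topspace X. f (h x) = g x)"
  then have "rel_TC Z X f g \<le> enat (card {topspace X})"
    using Z by (intro rel_TC_le) auto
  then show "rel_TC Z X f g \<le> 1"
    by (simp add: one_enat_def)
qed

section \<open>Coincidences and the configuration space\<close>

text \<open>The two directions use \<open>x \<mapsto> (g x, f x)\<close> and
  \<open>snd \<circ> h\<close>: a point of the configuration space over \<open>g x\<close> is a
  choice of a second point different from \<open>g x\<close>.\<close>

lemma coincidence_property_iff_no_lift:
  assumes g: "continuous_map X Y g"
  shows "coincidence_property X Y g \<longleftrightarrow>
         \<not> (\<exists>h. continuous_map X (conf2 Y) h \<and> (\<forall>x \<in> topspace X. fst (h x) = g x))"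
proof -
  have "\<exists>h. continuous_map X (conf2 Y) h \<and> (\<forall>x \<in> topspace X. fst (h x) = g x)"
    if "continuous_map X Y f" "\<forall>x \<in> topspace X. f x \<noteq> g x" for f
    using that g
    by (intro exI[of _ "\<lambda>x. (g x, f x)"])
      (force simp: conf2_def continuous_map_in_subtopology continuous_map_paired)
  moreover have "\<exists>f. continuous_map X Y f \<and> (\<forall>x \<in> topspace X. f x \<noteq> g x)"
    if h: "continuous_map X (conf2 Y) h" and fst: "\<forall>x \<in> topspace X. fst (h x) = g x" for h
  proof (intro exI[of _ "snd \<circ> h"] conjI ballI)
    have "continuous_map X (prod_topology Y Y) h"
      and im: "h \<in> topspace X \<rightarrow> {(y1, y2). y1 \<noteq> y2}"
      using h unfolding conf2_def continuous_map_in_subtopology by auto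
    then show "continuous_map X Y (snd \<circ> h)"
      by (intro continuous_map_compose[OF _ continuous_map_snd])
    show "(snd \<circ> h) x \<noteq> g x" if "x \<in> topspace X" for x
      using fst funcset_mem[OF im that] that by (simp add: case_prod_unfold)
  qed
  ultimately have "(\<exists>f. continuous_map X Y f \<and> (\<forall>x \<in> topspace X. f x \<noteq> g x)) \<longleftrightarrow>
      (\<exists>h. continuous_map X (conf2 Y) h \<and> (\<forall>x \<in> topspace X. fst (h x) = g x))"
    by (intro iffI; elim exE conjE)
  then show ?thesis
    by (simp add: coincidence_property_def) blast
qed

lemma rel_TC_conf2_le_2:
  assumes Y: "t1_space Y" and Z: "contractible_space (conf2 Y)" "topspace (conf2 Y) \<noteq> {}"
    and g: "continuous_map X Y g"
  shows "rel_TC (conf2 Y) X fst g \<le> 2"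
proof -
  \<comment> \<open>A point of the configuration space is itself a pair of distinct points of
    \<open>Y\<close>.\<close>
  obtain y1 y2 where y: "y1 \<in> topspace Y" "y2 \<in> topspace Y" "y1 \<noteq> y2"
    using Z by (auto simp: conf2_def)
  define V where "V y = {x \<in> topspace X. g x \<in> topspace Y - {y}}" for y
  have openV: "openin X (V y)" if "y \<in> topspace Y" for y
    unfolding V_def using Y that
    by (intro openin_continuous_map_preimage[OF g]) (simp add: openin_diff t1_space_closedin_singleton)
  have lift: "\<exists>h. continuous_map (subtopology X (V y)) (conf2 Y) h \<and> (\<forall>x \<in> V y. fst (h x) = g x)"
    if "y \<in> topspace Y" for y
    using that g
    by (intro exI[of _ "\<lambda>x. (g x, y)"])
      (auto simp: V_def conf2_def continuous_map_in_subtopology continuous_map_paired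
        continuous_map_from_subtopology)
  have "rel_TC (conf2 Y) X fst g \<le> enat (card {V y1, V y2})"
  proof (rule rel_TC_le[OF Z(1)])
    \<comment> \<open>No \<open>g x\<close> can equal both \<open>y1\<close> and
      \<open>y2\<close>.\<close>
    show "\<Union> {V y1, V y2} = topspace X"
      using y g by (auto simp: V_def continuous_map_def)
  qed (use y openV lift in auto)
  also have "\<dots> \<le> 2"
    \<comment> \<open>The two sets may coincide, for instance when \<open>g\<close> avoids both
      points, so the cardinality is only bounded by 2.\<close>
    using card_insert_le_m1[of 2 "{V y2}" "V y1"] by (simp add: numeral_eq_enat)
  finally show ?thesis .
qed

theorem proposition4p5:
  fixes X :: "'a topology" and Y :: "'b topology" and g :: "'a \<Rightarrow> 'b"
  assumes "Hausdorff_space Y"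
    and "contractible_space (conf2 Y)" and "topspace (conf2 Y) \<noteq> {}"
    and "continuous_map X Y g"
  shows "coincidence_property X Y g \<longleftrightarrow> rel_TC (conf2 Y) X fst g = 2"
proof -
  have le2: "rel_TC (conf2 Y) X fst g \<le> 2"
    using assms by (intro rel_TC_conf2_le_2 Hausdorff_imp_t1_space)
  have "coincidence_property X Y g \<longleftrightarrow> \<not> rel_TC (conf2 Y) X fst g \<le> 1"
    using assms by (simp add: coincidence_property_iff_no_lift rel_TC_le_1_iff)
  also have "\<dots> \<longleftrightarrow> rel_TC (conf2 Y) X fst g = 2"
    using le2 by (cases "rel_TC (conf2 Y) X fst g") (auto simp: one_enat_def numeral_eq_enat)
  finally show ?thesis .
qed

end
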